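(* Let $G$ be a compact group with identity $e$ and Haar probability measure $\nu$, let $A \subset G$ with $A = A^{-1}$ and $e \in A$, and let $W \leq G$ be a closed subgroup such that $wA = Aw = A$ for all $w \in W$. Let \[ B(G,A) = \inf\Big\{ h(e) : h \in C_{\succeq 0}(G) \text{ real-valued},\; h(g) \leq 0 \text{ for all } g \in A^c,\; \textstyle\int h\,d\nu = 1 \Big\}. \] Then $B(G,A)$ equals the infimum of the same problem with the additional constraint that $h(wg) = h(gw) = h(g)$ for all $g \in G$ and $w \in W$.
   Context: A continuous $f: G \to \mathbb{C}$ is positive definite ($f \in C_{\succeq 0}(G)$) if $\sum_{i,j=1}^n \overline{c_i} f(g_i^{-1} g_j) c_j \geq 0$ for all $n$, $g_i \in G$, $c_i\in\mathbb{C}$. $A^c$ is the complement of $A$ in $G$. *)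

theory Defs
  imports "HOL-Probability.Probability"
begin

text \<open>Groups are written additively (type class group_add, not necessarily commutative):
  identity 0, product g + h, inverse - g.\<close>

definition topological_group :: "'a::{topological_space,group_add} itself \<Rightarrow> bool" where
  "topological_group _ \<longleftrightarrow>
     continuous_on UNIV (\<lambda>p::'a \<times> 'a. fst p + snd p) \<and> continuous_on UNIV (uminus :: 'a \<Rightarrow> 'a)"

definition haar_prob :: "'a::{topological_space,group_add} measure \<Rightarrow> bool" where
  "haar_prob \<nu> \<longleftrightarrow> prob_space \<nu> \<and> sets \<nu> = sets borel \<and>
     (\<forall>g. \<forall>S\<in>sets borel. emeasure \<nu> ((\<lambda>x. g + x) ` S) = emeasure \<nu> S)"

definition pos_def_fun :: "('a::group_add \<Rightarrow> complex) \<Rightarrow> bool" where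
  "pos_def_fun f \<longleftrightarrow> (\<forall>(n::nat) (g::nat \<Rightarrow> 'a) (c::nat \<Rightarrow> complex).
     Im (\<Sum>i<n. \<Sum>j<n. cnj (c i) * f (- g i + g j) * c j) = 0 \<and>
     Re (\<Sum>i<n. \<Sum>j<n. cnj (c i) * f (- g i + g j) * c j) \<ge> 0)"

definition C_psd :: "('a::{topological_space,group_add} \<Rightarrow> complex) \<Rightarrow> bool" where
  "C_psd f \<longleftrightarrow> continuous_on UNIV f \<and> pos_def_fun f"

definition feasible :: "'a::{topological_space,group_add} measure \<Rightarrow> 'a set \<Rightarrow> ('a \<Rightarrow> real) set" where
  "feasible \<nu> A = {h. C_psd (\<lambda>x. complex_of_real (h x)) \<and> (\<forall>g. g \<notin> A \<longrightarrow> h g \<le> 0)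
                      \<and> integral\<^sup>L \<nu> h = 1}"

definition B_val :: "'a::{topological_space,group_add} measure \<Rightarrow> 'a set \<Rightarrow> real" where
  "B_val \<nu> A = Inf ((\<lambda>h. h 0) ` feasible \<nu> A)"

end

theory Submission
  imports Defs
begin

text \<open>
  Averaging a feasible \<open>h\<close> over \<open>W\<close> on both sides keeps it feasible and does not increase \<open>h 0\<close>,
  because a real positive definite function attains its maximum at \<open>0\<close>. Instead of a Haar measure
  on \<open>W\<close>, finite averages of translates are used. Among the left averages of \<open>h\<close> by elements of
  \<open>W\<close>, a sequence minimising the \<open>L\<^sup>2\<close> norm with respect to \<open>\<nu>\<close> is Cauchy in \<open>L\<^sup>2\<close> by the
  parallelogram law, hence uniformly Cauchy by equicontinuity, and its limit is left
  \<open>W\<close>-invariant by uniqueness of the minimiser. Using the weights of this sequence on both sides of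
  \<open>h\<close> gives positive definite functions that converge uniformly to a bi-invariant one.
\<close>

section \<open>Finitely supported averages of translates\<close>

text \<open>Finitely supported probability measures on \<open>W\<close>, encoded as total functions
  so that midpoints and translates of weights are easy to write down.\<close>

definition prob_weights :: "'a set \<Rightarrow> ('a \<Rightarrow> real) set" where
  "prob_weights W = {p. finite {w. p w \<noteq> 0} \<and> {w. p w \<noteq> 0} \<subseteq> W \<and> (\<forall>w. 0 \<le> p w)
                        \<and> (\<Sum>w | p w \<noteq> 0. p w) = 1}"

definition left_avg :: "('a::group_add \<Rightarrow> real) \<Rightarrow> ('a \<Rightarrow> real) \<Rightarrow> 'a \<Rightarrow> real" where
  "left_avg p f g = (\<Sum>w | p w \<noteq> 0. p w * f (- w + g))"

text \<open>\<open>left_avg p f\<close> is the convolution of \<open>p\<close> with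
  \<open>f\<close>, whereas \<open>right_avg p f\<close> is the convolution of \<open>f\<close> with
  the reflected weight \<open>p (- w)\<close>. Using \<open>p\<close> on one side and its reflection
  on the other is what preserves positive definiteness.\<close>

definition right_avg :: "('a::group_add \<Rightarrow> real) \<Rightarrow> ('a \<Rightarrow> real) \<Rightarrow> 'a \<Rightarrow> real" where
  "right_avg p f g = (\<Sum>w | p w \<noteq> 0. p w * f (g + w))"

lemma prob_weightsD:
  assumes "p \<in> prob_weights W"
  shows "finite {w. p w \<noteq> 0}" "\<And>w. p w \<noteq> 0 \<Longrightarrow> w \<in> W" "\<And>w. 0 \<le> p w"
    "(\<Sum>w | p w \<noteq> 0. p w) = 1"
  using assms by (auto simp: prob_weights_def)

lemma prob_weights_mono: "W \<subseteq> V \<Longrightarrow> prob_weights W \<subseteq> prob_weights V"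
  by (auto simp: prob_weights_def)

lemma left_avg_superset:
  assumes "finite S" "{w. p w \<noteq> 0} \<subseteq> S"
  shows "left_avg p f g = (\<Sum>w\<in>S. p w * f (- w + g))"
  unfolding left_avg_def by (rule sum.mono_neutral_left) (use assms in auto)

lemma prob_weights_point: "a \<in> W \<Longrightarrow> (\<lambda>w. if w = a then 1 else 0) \<in> prob_weights W"
  by (auto simp: prob_weights_def)

text \<open>Convexity, as used by the parallelogram law: the midpoint of two averages is again an
  average, so the infimum of the norms also bounds it from below.\<close>

lemma prob_weights_midpoint:
  assumes p: "p \<in> prob_weights W" and q: "q \<in> prob_weights W"
  shows "(\<lambda>w. (p w + q w) / 2) \<in> prob_weights W" (is "?r \<in> _")
    and "left_avg (\<lambda>w. (p w + q w) / 2) f g = (left_avg p f g + left_avg q f g) / 2"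
proof -
  note P = prob_weightsD[OF p] and Q = prob_weightsD[OF q]
  let ?S = "{w. p w \<noteq> 0} \<union> {w. q w \<noteq> 0}"
  have S: "finite ?S" "?S \<subseteq> W" using P Q by auto
  have supp: "{w. ?r w \<noteq> 0} \<subseteq> ?S" by auto
  have "(\<Sum>w | ?r w \<noteq> 0. ?r w) = (\<Sum>w\<in>?S. ?r w)"
    by (rule sum.mono_neutral_left) (use S in auto)
  also have "\<dots> = ((\<Sum>w\<in>?S. p w) + (\<Sum>w\<in>?S. q w)) / 2"
    by (simp add: sum.distrib sum_divide_distrib[symmetric])
  also have "(\<Sum>w\<in>?S. p w) = (\<Sum>w | p w \<noteq> 0. p w)"
    by (rule sum.mono_neutral_right) (use S in auto)
  also have "(\<Sum>w\<in>?S. q w) = (\<Sum>w | q w \<noteq> 0. q w)"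
    by (rule sum.mono_neutral_right) (use S in auto)
  finally have "(\<Sum>w | ?r w \<noteq> 0. ?r w) = 1" using P Q by simp
  then show "?r \<in> prob_weights W"
    using P(3) Q(3) S finite_subset[OF supp] supp by (auto simp: prob_weights_def)
  show "left_avg ?r f g = (left_avg p f g + left_avg q f g) / 2"
    unfolding left_avg_superset[OF S(1) supp]
      left_avg_superset[OF S(1) Un_upper1] left_avg_superset[OF S(1) Un_upper2]
    by (simp add: sum.distrib[symmetric] sum_divide_distrib algebra_simps add_divide_distrib)
qed

text \<open>A \<open>W\<close>-translate of an average is an average of the same function. Hence
  translating a minimising sequence stays within the set over which the norm is minimised.\<close>

lemma prob_weights_translate:
  fixes W :: "'a::group_add set"
  assumes p: "p \<in> prob_weights W" and a: "a \<in> W" and W: "\<And>x y. x \<in> W \<Longrightarrow> y \<in> W \<Longrightarrow> x + y \<in> W"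
  shows "(\<lambda>w. p (- a + w)) \<in> prob_weights W"
    and "left_avg (\<lambda>w. p (- a + w)) f g = left_avg p f (- a + g)"
proof -
  note P = prob_weightsD[OF p]
  have supp: "{w. p (- a + w) \<noteq> 0} = (+) a ` {w. p w \<noteq> 0}"
    by (auto simp: image_iff) (metis add_minus_cancel)
  show "(\<lambda>w. p (- a + w)) \<in> prob_weights W"
  proof -
    have "(\<Sum>w | p (- a + w) \<noteq> 0. p (- a + w)) = 1"
      unfolding supp using P(4) by (simp add: sum.reindex)
    moreover have "finite {w. p (- a + w) \<noteq> 0}" unfolding supp using P(1) by simp
    moreover have "{w. p (- a + w) \<noteq> 0} \<subseteq> W" unfolding supp using P(2) W a by auto
    ultimately show ?thesis using P(3) by (simp add: prob_weights_def)
  qed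
  show "left_avg (\<lambda>w. p (- a + w)) f g = left_avg p f (- a + g)"
    unfolding left_avg_def supp by (simp add: sum.reindex minus_add add.assoc diff_conv_add_uminus del: add_uminus_conv_diff)
qed

lemma right_avg_eq_left_avg: "right_avg p f g = left_avg p (\<lambda>x. f (- x)) (- g)"
  by (simp add: left_avg_def right_avg_def minus_add)

lemma left_avg_right_avg_commute:
  "left_avg p (right_avg q f) g = right_avg q (left_avg p f) g"
  unfolding left_avg_def right_avg_def sum_distrib_left
  by (subst sum.swap) (simp add: add.assoc mult.left_commute)

lemma left_avg_le:
  assumes p: "p \<in> prob_weights W" and le: "\<And>w. w \<in> W \<Longrightarrow> f (- w + g) \<le> c"
  shows "left_avg p f g \<le> c"
proof -
  note P = prob_weightsD[OF p]
  have "left_avg p f g \<le> (\<Sum>w | p w \<noteq> 0. p w * c)"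
    unfolding left_avg_def by (intro sum_mono mult_left_mono le P) auto
  also have "\<dots> = c" using P(4) by (simp add: sum_distrib_right[symmetric])
  finally show ?thesis .
qed

text \<open>Averaging is a contraction. Two functions and two points are allowed so that the bound
  covers both oscillation (\<open>f = f'\<close>) and uniform approximation
  (\<open>g = g'\<close>).\<close>

lemma left_avg_close:
  assumes p: "p \<in> prob_weights W" and le: "\<And>w. w \<in> W \<Longrightarrow> \<bar>f (- w + g) - f' (- w + g')\<bar> \<le> c"
  shows "\<bar>left_avg p f g - left_avg p f' g'\<bar> \<le> c"
proof -
  note P = prob_weightsD[OF p]
  have "\<bar>left_avg p f g - left_avg p f' g'\<bar> = \<bar>\<Sum>w | p w \<noteq> 0. p w * (f (- w + g) - f' (- w + g'))\<bar>"
    by (simp add: left_avg_def sum_subtractf[symmetric] algebra_simps)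
  also have "\<dots> \<le> (\<Sum>w | p w \<noteq> 0. \<bar>p w * (f (- w + g) - f' (- w + g'))\<bar>)"
    by (rule sum_abs)
  also have "\<dots> \<le> (\<Sum>w | p w \<noteq> 0. p w * c)"
    using P by (intro sum_mono) (auto simp: abs_mult intro!: mult_left_mono le)
  also have "\<dots> = c" using P(4) by (simp add: sum_distrib_right[symmetric])
  finally show ?thesis .
qed

lemma right_avg_le:
  assumes "p \<in> prob_weights W" and "\<And>w. w \<in> W \<Longrightarrow> f (g + w) \<le> c"
  shows "right_avg p f g \<le> c"
  unfolding right_avg_eq_left_avg using assms by (intro left_avg_le) (auto simp: minus_add)

lemma right_avg_close:
  assumes "p \<in> prob_weights W" and "\<And>w. w \<in> W \<Longrightarrow> \<bar>f (g + w) - f' (g' + w)\<bar> \<le> c"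
  shows "\<bar>right_avg p f g - right_avg p f' g'\<bar> \<le> c"
  unfolding right_avg_eq_left_avg using assms by (intro left_avg_close) (auto simp: minus_add)

section \<open>Real positive definite functions\<close>

text \<open>An enumeration of \<open>I\<close> reduces this to the definition. Arbitrary index sets
  are convenient because the averaged form is indexed by pairs.\<close>

lemma pos_def_fun_finite_sum:
  fixes g :: "'i \<Rightarrow> 'a::group_add"
  assumes f: "pos_def_fun f" and I: "finite I"
  shows "Im (\<Sum>i\<in>I. \<Sum>j\<in>I. cnj (c i) * f (- g i + g j) * c j) = 0"
    and "Re (\<Sum>i\<in>I. \<Sum>j\<in>I. cnj (c i) * f (- g i + g j) * c j) \<ge> 0"
proof -
  obtain b where b: "bij_betw b {..<card I} I"
    using ex_bij_betw_nat_finite[OF I] by (auto simp: atLeast0LessThan)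
  have *: "(\<Sum>i\<in>I. \<Sum>j\<in>I. cnj (c i) * f (- g i + g j) * c j) =
    (\<Sum>i<card I. \<Sum>j<card I. cnj (c (b i)) * f (- g (b i) + g (b j)) * c (b j))"
    by (simp add: sum.reindex_bij_betw[OF b, symmetric])
  show "Im (\<Sum>i\<in>I. \<Sum>j\<in>I. cnj (c i) * f (- g i + g j) * c j) = 0"
    and "Re (\<Sum>i\<in>I. \<Sum>j\<in>I. cnj (c i) * f (- g i + g j) * c j) \<ge> 0"
    unfolding * using f[unfolded pos_def_fun_def, rule_format, of "\<lambda>i. c (b i)" "\<lambda>i. g (b i)" "card I"]
    by auto
qed

text \<open>At the points \<open>0\<close>, \<open>g\<close> with coefficients 1 and
  \<open>\<i>\<close> the form equals \<open>2 * h 0 + \<i> * (h g - h (- g))\<close>, and its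
  imaginary part vanishes.\<close>

lemma pos_def_real_even:
  assumes "pos_def_fun (\<lambda>x. complex_of_real (h x))"
  shows "h (- g) = h g"
  using pos_def_fun_finite_sum(1)[OF assms, of "{0, 1::nat}" "\<lambda>i. if i = 0 then 1 else \<i>" "\<lambda>i. if i = 0 then 0 else g"]
  by simp

text \<open>With coefficients 1 and -1 the form is \<open>2 * h 0 - h g - h (- g)\<close>, which by
  evenness is twice \<open>h 0 - h g\<close>.\<close>

lemma pos_def_real_le:
  assumes "pos_def_fun (\<lambda>x. complex_of_real (h x))"
  shows "h g \<le> h 0"
  using pos_def_fun_finite_sum(2)[OF assms, of "{0, 1::nat}" "\<lambda>i. if i = 0 then 1 else - 1" "\<lambda>i. if i = 0 then 0 else g"]
    pos_def_real_even[OF assms, of g]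
  by simp

text \<open>The averaged quadratic form is the form of \<open>h\<close> at the points \<open>g i + w\<close>
  with coefficients \<open>p w * c i\<close>.\<close>
lemma pos_def_two_sided_avg:
  assumes h: "pos_def_fun (\<lambda>x. complex_of_real (h x))" and fin: "finite {w. p w \<noteq> 0}"
  shows "pos_def_fun (\<lambda>x. complex_of_real (left_avg p (right_avg p h) x))"
  unfolding pos_def_fun_def
proof (intro allI)
  fix n :: nat and g :: "nat \<Rightarrow> 'a" and c :: "nat \<Rightarrow> complex"
  let ?S = "{w. p w \<noteq> 0}"
  let ?c = "\<lambda>(i, w). complex_of_real (p w) * c i" and ?g = "\<lambda>(i, w). g i + w"
  have "(\<Sum>i<n. \<Sum>j<n. cnj (c i) * complex_of_real (left_avg p (right_avg p h) (- g i + g j)) * c j)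
    = (\<Sum>i<n. \<Sum>j<n. \<Sum>w\<in>?S. \<Sum>w'\<in>?S. cnj (?c (i, w)) * complex_of_real (h (- ?g (i, w) + ?g (j, w'))) * ?c (j, w'))"
    by (simp add: left_avg_def right_avg_def sum_distrib_left sum_distrib_right minus_add add.assoc
        diff_conv_add_uminus mult_ac del: add_uminus_conv_diff)
  also have "\<dots> = (\<Sum>i<n. \<Sum>w\<in>?S. \<Sum>j<n. \<Sum>w'\<in>?S. cnj (?c (i, w)) * complex_of_real (h (- ?g (i, w) + ?g (j, w'))) * ?c (j, w'))"
    by (intro sum.cong refl sum.swap)
  also have "\<dots> = (\<Sum>x\<in>{..<n} \<times> ?S. \<Sum>y\<in>{..<n} \<times> ?S. cnj (?c x) * complex_of_real (h (- ?g x + ?g y)) * ?c y)"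
    by (simp only: sum.cartesian_product')
  finally have eq: "(\<Sum>i<n. \<Sum>j<n. cnj (c i) * complex_of_real (left_avg p (right_avg p h) (- g i + g j)) * c j) = \<dots>" .
  have "finite ({..<n} \<times> ?S)" using fin by simp
  from pos_def_fun_finite_sum[OF h this, of ?c ?g]
  show "Im (\<Sum>i<n. \<Sum>j<n. cnj (c i) * complex_of_real (left_avg p (right_avg p h) (- g i + g j)) * c j) = 0 \<and>
        0 \<le> Re (\<Sum>i<n. \<Sum>j<n. cnj (c i) * complex_of_real (left_avg p (right_avg p h) (- g i + g j)) * c j)"
    unfolding eq by blast
qed

text \<open>For fixed points and coefficients the form is a finite sum, so pointwise convergence
  preserves both conditions.\<close>

lemma pos_def_fun_limit:
  assumes f: "\<And>n. pos_def_fun (f n)" and lim: "\<And>x. (\<lambda>n. f n x) \<longlonglongrightarrow> f' x"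
  shows "pos_def_fun f'"
  unfolding pos_def_fun_def
proof (intro allI conjI)
  fix n :: nat and g :: "nat \<Rightarrow> 'a" and c :: "nat \<Rightarrow> complex"
  let ?s = "\<lambda>f. \<Sum>i<n. \<Sum>j<n. cnj (c i) * f (- g i + g j) * c j"
  have s: "(\<lambda>k. ?s (f k)) \<longlonglongrightarrow> ?s f'" by (intro tendsto_intros lim)
  have "Im (?s (f k)) = 0" "0 \<le> Re (?s (f k))" for k
    using f[of k] unfolding pos_def_fun_def by blast+
  with tendsto_Im[OF s] tendsto_Re[OF s] show "Im (?s f') = 0" "0 \<le> Re (?s f')"
    by (simp_all add: LIMSEQ_const_iff LIMSEQ_le_const)
qed

section \<open>Compact groups with a Haar probability measure\<close>

text \<open>\<open>haar_prob\<close> postulates left invariance only; right invariance of integrals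
  of continuous functions is derived in \<open>integral_right_translate\<close>.\<close>

locale compact_haar_group =
  fixes \<nu> :: "'a::{topological_space,group_add} measure"
  assumes topological_group: "topological_group TYPE('a)"
    and compact_UNIV: "compact (UNIV :: 'a set)"
    and haar: "haar_prob \<nu>"
begin

sublocale prob_space \<nu>
  using haar by (simp add: haar_prob_def)

lemma sets_haar [measurable_cong]: "sets \<nu> = sets borel"
  using haar by (simp add: haar_prob_def)

lemma continuous_on_add_group:
  fixes f g :: "'b::topological_space \<Rightarrow> 'a"
  assumes "continuous_on S f" "continuous_on S g"
  shows "continuous_on S (\<lambda>x. f x + g x)"
proof -
  have "continuous_on UNIV (\<lambda>p::'a \<times> 'a. fst p + snd p)"
    using topological_group by (simp add: topological_group_def)
  from continuous_on_compose2[OF this continuous_on_Pair[OF assms]] show ?thesis by simp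
qed

lemma continuous_on_uminus_group:
  fixes f :: "'b::topological_space \<Rightarrow> 'a"
  assumes "continuous_on S f"
  shows "continuous_on S (\<lambda>x. - f x)"
proof -
  have "continuous_on UNIV (uminus :: 'a \<Rightarrow> 'a)"
    using topological_group by (simp add: topological_group_def)
  from continuous_on_compose2[OF this assms] show ?thesis by simp
qed

lemmas group_continuous_intros = continuous_on_add_group continuous_on_uminus_group

lemma continuous_on_left_translate:
  "continuous_on UNIV f \<Longrightarrow> continuous_on UNIV (\<lambda>x::'a. f (a + x))"
  by (erule continuous_on_compose2) (intro group_continuous_intros continuous_intros, simp)

lemma continuous_on_right_translate:
  "continuous_on UNIV f \<Longrightarrow> continuous_on UNIV (\<lambda>x::'a. f (x + a))"
  by (erule continuous_on_compose2) (intro group_continuous_intros continuous_intros, simp)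

lemma continuous_on_left_avg:
  fixes f :: "'a \<Rightarrow> real"
  assumes "continuous_on UNIV f"
  shows "continuous_on UNIV (left_avg p f)"
  unfolding left_avg_def by (intro continuous_intros continuous_on_left_translate assms)

lemma continuous_on_right_avg:
  fixes f :: "'a \<Rightarrow> real"
  assumes "continuous_on UNIV f"
  shows "continuous_on UNIV (right_avg p f)"
  unfolding right_avg_def by (intro continuous_intros continuous_on_right_translate assms)

lemma integrable_continuous:
  fixes f :: "'a \<Rightarrow> real"
  assumes f: "continuous_on UNIV f"
  shows "integrable \<nu> f"
proof -
  obtain B where "\<And>x. norm (f x) \<le> B"
    using compact_imp_bounded[OF compact_continuous_image[OF f compact_UNIV]]
    by (auto simp: bounded_iff)
  moreover have "f \<in> borel_measurable \<nu>"
    using borel_measurable_continuous_onI[OF f] by measurable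
  ultimately show ?thesis
    by (intro integrable_const_bound[of _ B]) auto
qed

lemma image_add_eq_vimage: "(+) g ` S = (\<lambda>x. - g + x) -` S" for g :: 'a
  by (auto simp: image_iff) (metis add_minus_cancel)

lemma open_translate: "open S \<Longrightarrow> open ((+) g ` S)" for g :: 'a
  unfolding image_add_eq_vimage
  by (intro open_vimage group_continuous_intros continuous_intros)

lemma integral_left_translate:
  fixes f :: "'a \<Rightarrow> real"
  assumes f: "continuous_on UNIV f"
  shows "(\<integral>x. f (g + x) \<partial>\<nu>) = (\<integral>x. f x \<partial>\<nu>)"
proof -
  have "continuous_on UNIV (\<lambda>x::'a. g + x)" for g
    by (intro group_continuous_intros continuous_intros)
  then have "(\<lambda>x::'a. g + x) \<in> borel_measurable borel" for g
    by (rule borel_measurable_continuous_onI)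
  then have meas [measurable]: "(\<lambda>x. g + x) \<in> measurable \<nu> borel" for g by measurable
  have "distr \<nu> borel (\<lambda>x. g + x) = \<nu>"
  proof (rule measure_eqI)
    fix S assume "S \<in> sets (distr \<nu> borel (\<lambda>x. g + x))"
    then have S: "S \<in> sets borel" by simp
    \<comment> \<open>Invariance is stated for images of sets but \<open>distr\<close> uses
      preimages; the preimage under translation by \<open>g\<close> is the image under translation
      by \<open>- g\<close>.\<close>
    have "(+) (- g) ` S = (\<lambda>x. g + x) -` S"
      using image_add_eq_vimage[of "- g" S] by simp
    moreover have "emeasure \<nu> ((+) (- g) ` S) = emeasure \<nu> S"
      using haar S by (auto simp: haar_prob_def)
    moreover have "space \<nu> = UNIV" using sets_eq_imp_space_eq[OF sets_haar] by simp
    ultimately show "emeasure (distr \<nu> borel (\<lambda>x. g + x)) S = emeasure \<nu> S"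
      using S by (simp add: emeasure_distr)
  qed (simp add: sets_haar)
  moreover have "(\<integral>x. f (g + x) \<partial>\<nu>) = (\<integral>x. f x \<partial>distr \<nu> borel (\<lambda>x. g + x))"
    by (rule integral_distr[symmetric]) (use borel_measurable_continuous_onI[OF f] in auto)
  ultimately show ?thesis by simp
qed

text \<open>If \<open>U\<close> were null, so would be its translates. Finitely many of these cover
  the compact group, which has measure 1.\<close>

lemma measure_open_pos:
  assumes U: "open U" "0 \<in> U"
  shows "measure \<nu> U > 0"
proof (rule ccontr)
  assume "\<not> ?thesis"
  then have "measure \<nu> U = 0" using measure_nonneg[of \<nu> U] by linarith
  then have "emeasure \<nu> U = 0" by (simp add: emeasure_eq_measure)
  then have null: "(+) g ` U \<in> null_sets \<nu>" for g
    using haar U open_translate[of U g] by (auto simp: haar_prob_def null_sets_def)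
  have "UNIV \<subseteq> (\<Union>g\<in>UNIV. (+) g ` U)" using U(2) by (auto simp: image_iff) (metis add.right_neutral)
  then obtain D where D: "finite D" "UNIV \<subseteq> (\<Union>g\<in>D. (+) g ` U)"
    using compactE_image[OF compact_UNIV, of UNIV "\<lambda>g. (+) g ` U"] open_translate[OF U(1)] by metis
  have "(\<Union>g\<in>D. (+) g ` U) \<in> null_sets \<nu>"
    by (rule null_sets_UN') (use D null in \<open>auto intro: countable_finite\<close>)
  moreover have "(\<Union>g\<in>D. (+) g ` U) = space \<nu>"
    using D sets_eq_imp_space_eq[OF sets_haar] by auto
  ultimately show False using emeasure_space_1 by auto
qed

text \<open>The tube lemma around \<open>{0} \<times> UNIV\<close> yields one neighbourhood for all
  \<open>x\<close>. The increment stands on the right, so it is unaffected by the left translations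
  inside \<open>left_avg\<close>.\<close>

lemma uniformly_continuous:
  fixes f :: "'a \<Rightarrow> real"
  assumes f: "continuous_on UNIV f" and e: "e > 0"
  obtains U where "open U" "0 \<in> U" "\<And>x u. u \<in> U \<Longrightarrow> \<bar>f (x + u) - f x\<bar> < e"
proof -
  let ?V = "{p::'a \<times> 'a. \<bar>f (snd p + fst p) - f (snd p)\<bar> < e}"
  have "open ?V"
    by (intro open_Collect_less continuous_intros continuous_on_compose2[OF f] group_continuous_intros) auto
  moreover have "{0} \<times> UNIV \<subseteq> ?V" using e by auto
  ultimately obtain U where "0 \<in> U" "open U" "U \<times> UNIV \<subseteq> ?V"
    using Elementary_Topology.tube_lemma[OF compact_UNIV] by blast
  then show thesis
    using that[of U] by (metis (no_types, lifting) SigmaI UNIV_I fst_conv mem_Collect_eq snd_conv subsetD)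
qed

text \<open>All averages share the modulus of continuity of \<open>f\<close>, so a large pointwise distance
  persists on a translate of one fixed neighbourhood of \<open>0\<close>.\<close>
lemma left_avg_L2_small_imp_uniformly_small:
  fixes f :: "'a \<Rightarrow> real"
  assumes f: "continuous_on UNIV f" and e: "e > 0"
  obtains d where "d > 0"
    "\<And>p q x. \<lbrakk>p \<in> prob_weights UNIV; q \<in> prob_weights UNIV;
        (\<integral>x. (left_avg p f x - left_avg q f x)\<^sup>2 \<partial>\<nu>) < d\<rbrakk> \<Longrightarrow> \<bar>left_avg p f x - left_avg q f x\<bar> \<le> e"
proof -
  \<comment> \<open>On \<open>x + U\<close> each of the two averages moves by at most
    \<open>e / 4\<close>, so a difference above \<open>e\<close> at \<open>x\<close> stays at least
    \<open>e / 2\<close> there and contributes \<open>(e/2)\<^sup>2 * measure \<nu> U\<close> to the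
    integral.\<close>
  obtain U where U: "open U" "0 \<in> U" "\<And>x u. u \<in> U \<Longrightarrow> \<bar>f (x + u) - f x\<bar> < e / 4"
    by (rule uniformly_continuous[OF f, of "e / 4"]) (use e in auto)
  show thesis
  proof (rule that[of "(e/2)\<^sup>2 * measure \<nu> U"])
    show "(e/2)\<^sup>2 * measure \<nu> U > 0" using measure_open_pos[OF U(1,2)] e by simp
    fix p q :: "'a \<Rightarrow> real" and x
    assume p: "p \<in> prob_weights UNIV" and q: "q \<in> prob_weights UNIV"
      and small: "(\<integral>x. (left_avg p f x - left_avg q f x)\<^sup>2 \<partial>\<nu>) < (e/2)\<^sup>2 * measure \<nu> U"
    let ?k = "\<lambda>x. left_avg p f x - left_avg q f x"
    show "\<bar>?k x\<bar> \<le> e"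
    proof (rule ccontr)
      assume big: "\<not> \<bar>?k x\<bar> \<le> e"
      have osc: "\<bar>left_avg r f (x + u) - left_avg r f x\<bar> \<le> e / 4"
        if "u \<in> U" "r \<in> prob_weights UNIV" for u r
        by (rule left_avg_close[OF that(2)]) (use U(3)[OF that(1)] in \<open>auto simp: add.assoc[symmetric] less_imp_le\<close>)
      have "e / 2 \<le> \<bar>?k y\<bar>" if "y \<in> (+) x ` U" for y
        using that osc[OF _ p] osc[OF _ q] big by (auto; smt (verit, best) field_sum_of_halves)
      then have "(e/2)\<^sup>2 \<le> (?k y)\<^sup>2" if "y \<in> (+) x ` U" for y
        using that e by (intro abs_le_square_iff[THEN iffD1]) auto
      then have le: "(e/2)\<^sup>2 * indicator ((+) x ` U) y \<le> (?k y)\<^sup>2" for y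
        by (auto simp: indicator_def)
      have sU: "(+) x ` U \<in> sets \<nu>" using open_translate[OF U(1)] by (simp add: sets_haar)
      have "measure \<nu> ((+) x ` U) = measure \<nu> U"
        using haar U(1) by (simp add: haar_prob_def measure_def)
      then have "(e/2)\<^sup>2 * measure \<nu> U = (\<integral>y. (e/2)\<^sup>2 * indicator ((+) x ` U) y \<partial>\<nu>)"
        using sets.sets_into_space[OF sU] by (simp add: Int_absorb2)
      also have "\<dots> \<le> (\<integral>y. (?k y)\<^sup>2 \<partial>\<nu>)"
      proof (rule integral_mono[OF _ _ le])
        show "integrable \<nu> (\<lambda>y. (e/2)\<^sup>2 * indicator ((+) x ` U) y)"
          using sU by (intro integrable_mult_right integrable_real_indicator) (auto simp: emeasure_eq_measure)
        show "integrable \<nu> (\<lambda>y. (?k y)\<^sup>2)"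
          by (intro integrable_continuous continuous_intros continuous_on_left_avg f)
      qed
      finally show False using small by simp
    qed
  qed
qed

section \<open>The left-invariant limit of minimising averages\<close>

text \<open>The weights are returned along with the limit because they are reused: on the right-hand
  side of \<open>h\<close> in the symmetrization and, for \<open>W = UNIV\<close>, on right
  translates of \<open>f\<close>.\<close>

lemma left_invariant_mean:
  fixes W :: "'a set" and f :: "'a \<Rightarrow> real"
  assumes f: "continuous_on UNIV f"
    and W0: "0 \<in> W" and Wadd: "\<And>x y. x \<in> W \<Longrightarrow> y \<in> W \<Longrightarrow> x + y \<in> W"
    and Wminus: "\<And>x. x \<in> W \<Longrightarrow> - x \<in> W"
  obtains u P where "continuous_on UNIV u" "\<And>w g. w \<in> W \<Longrightarrow> u (w + g) = u g"
    "\<And>n. P n \<in> prob_weights W" "uniform_limit UNIV (\<lambda>n. left_avg (P n) f) u sequentially"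
proof -
  define \<Phi> where "\<Phi> p = (\<integral>x. (left_avg p f x)\<^sup>2 \<partial>\<nu>)" for p
  define m where "m = Inf (\<Phi> ` prob_weights W)"
  have bdd: "bdd_below (\<Phi> ` prob_weights W)"
    by (rule bdd_belowI[of _ 0]) (auto simp: \<Phi>_def)
  have m_le: "m \<le> \<Phi> p" if "p \<in> prob_weights W" for p
    unfolding m_def by (rule cInf_lower) (use that bdd in auto)
  have "\<exists>p. p \<in> prob_weights W \<and> \<Phi> p < m + inverse (real (Suc n))" for n
  proof -
    have "Inf (\<Phi> ` prob_weights W) < m + inverse (real (Suc n))" by (simp add: m_def)
    from cInf_lessD[OF _ this] show ?thesis using prob_weights_point[OF W0] by auto
  qed
  then obtain P where P: "\<And>n. P n \<in> prob_weights W" "\<And>n. \<Phi> (P n) < m + inverse (real (Suc n))"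
    by metis
  have PU: "p \<in> prob_weights UNIV" if "p \<in> prob_weights W" for p
    using that prob_weights_mono[of W UNIV] by auto
  have int: "integrable \<nu> (\<lambda>x. k x)" if "continuous_on UNIV k" for k :: "'a \<Rightarrow> real"
    using integrable_continuous[OF that] .
  \<comment> \<open>The squared distance is twice the sum of the two squared norms minus four times
    that of the midpoint, and the latter is at least \<open>m\<close>.\<close>
  have parallelogram: "(\<integral>x. (left_avg p f x - left_avg q f x)\<^sup>2 \<partial>\<nu>) \<le> 2 * (\<Phi> p - m) + 2 * (\<Phi> q - m)"
    if p: "p \<in> prob_weights W" and q: "q \<in> prob_weights W" for p q
  proof -
    let ?r = "\<lambda>w. (p w + q w) / 2"
    have "(\<integral>x. (left_avg p f x - left_avg q f x)\<^sup>2 \<partial>\<nu>)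
      = (\<integral>x. 2 * (left_avg p f x)\<^sup>2 + 2 * (left_avg q f x)\<^sup>2 - 4 * (left_avg ?r f x)\<^sup>2 \<partial>\<nu>)"
      unfolding prob_weights_midpoint(2)[OF p q]
      by (rule Bochner_Integration.integral_cong) (auto simp: power2_eq_square field_simps)
    also have "\<dots> = 2 * \<Phi> p + 2 * \<Phi> q - 4 * \<Phi> ?r"
      unfolding \<Phi>_def
      by (simp add: int continuous_intros continuous_on_left_avg[OF f])
    finally show ?thesis using m_le[OF prob_weights_midpoint(1)[OF p q]] by simp
  qed
  \<comment> \<open>Stated for arbitrary near-minimisers, not only for members of \<open>P\<close>:
    this gives the Cauchy property and also the comparison of \<open>P n\<close> with its
    translates.\<close>
  have close: "\<exists>N. \<forall>n\<ge>N. \<forall>p q x. p \<in> prob_weights W \<longrightarrow> q \<in> prob_weights W \<longrightarrow>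
      \<Phi> p < m + inverse (real (Suc n)) \<longrightarrow> \<Phi> q < m + inverse (real (Suc n)) \<longrightarrow>
      \<bar>left_avg p f x - left_avg q f x\<bar> \<le> e" if e: "e > 0" for e
  proof -
    obtain d where d: "d > 0" "\<And>p q x. \<lbrakk>p \<in> prob_weights UNIV; q \<in> prob_weights UNIV;
        (\<integral>x. (left_avg p f x - left_avg q f x)\<^sup>2 \<partial>\<nu>) < d\<rbrakk> \<Longrightarrow> \<bar>left_avg p f x - left_avg q f x\<bar> \<le> e"
      using left_avg_L2_small_imp_uniformly_small[OF f e] by blast
    obtain N where N: "inverse (real (Suc N)) < d / 4"
      using reals_Archimedean[of "d / 4"] d(1) by auto
    show ?thesis
    proof (intro exI[of _ N] allI impI)
      fix n p q x
      assume n: "N \<le> n" and p: "p \<in> prob_weights W" and q: "q \<in> prob_weights W"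
        and \<Phi>: "\<Phi> p < m + inverse (real (Suc n))" "\<Phi> q < m + inverse (real (Suc n))"
      have "inverse (real (Suc n)) \<le> inverse (real (Suc N))"
        using n by (intro le_imp_inverse_le) auto
      with N have "inverse (real (Suc n)) < d / 4" by (rule le_less_trans[rotated])
      with \<Phi> have "\<Phi> p - m < d / 4" "\<Phi> q - m < d / 4" by linarith+
      then have "2 * (\<Phi> p - m) + 2 * (\<Phi> q - m) < d" by (simp add: field_simps)
      with parallelogram[OF p q] have "(\<integral>x. (left_avg p f x - left_avg q f x)\<^sup>2 \<partial>\<nu>) < d"
        by (rule le_less_trans)
      from d(2)[OF PU[OF p] PU[OF q] this]
      show "\<bar>left_avg p f x - left_avg q f x\<bar> \<le> e" .
    qed
  qed
  have P_mono: "\<Phi> (P k) < m + inverse (real (Suc n))" if "n \<le> k" for n k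
  proof -
    have "inverse (real (Suc k)) \<le> inverse (real (Suc n))"
      using that by (intro le_imp_inverse_le) auto
    with P(2)[of k] show ?thesis by linarith
  qed
  have "uniformly_Cauchy_on UNIV (\<lambda>n. left_avg (P n) f)"
  proof (rule uniformly_Cauchy_onI)
    fix e :: real assume e: "e > 0"
    then obtain N where N: "\<And>n p q x. \<lbrakk>n \<ge> N; p \<in> prob_weights W; q \<in> prob_weights W;
      \<Phi> p < m + inverse (real (Suc n)); \<Phi> q < m + inverse (real (Suc n))\<rbrakk> \<Longrightarrow>
      \<bar>left_avg p f x - left_avg q f x\<bar> \<le> e / 2" using close[of "e / 2"] by force
    have "dist (left_avg (P k) f x) (left_avg (P n) f x) < e" if "k \<ge> N" "n \<ge> N" for k n x
      using N[OF order_refl P(1) P(1) P_mono[OF that(1)] P_mono[OF that(2)], of x] e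
      unfolding dist_real_def by linarith
    then show "\<exists>M. \<forall>x\<in>UNIV. \<forall>k\<ge>M. \<forall>n\<ge>M. dist (left_avg (P k) f x) (left_avg (P n) f x) < e"
      by blast
  qed
  then obtain u where u: "uniform_limit UNIV (\<lambda>n. left_avg (P n) f) u sequentially"
    using Cauchy_uniformly_convergent uniformly_convergent_on_def by blast
  have cont: "continuous_on UNIV u"
    by (rule uniform_limit_theorem[OF _ u]) (auto simp: continuous_on_left_avg[OF f])
  have lim: "(\<lambda>n. left_avg (P n) f x) \<longlonglongrightarrow> u x" for x
    by (rule tendsto_uniform_limitI[OF u]) simp
  \<comment> \<open>Left invariance of \<open>\<nu>\<close> gives the translated weight the same
    \<open>\<Phi>\<close> as \<open>P n\<close>, so it is an equally good near-minimiser and its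
    average is uniformly close to that of \<open>P n\<close>.\<close>
  have inv: "u (- w + g) = u g" if w: "w \<in> W" for w g
  proof -
    have tr: "(\<lambda>v. P n (- w + v)) \<in> prob_weights W"
      "left_avg (\<lambda>v. P n (- w + v)) f x = left_avg (P n) f (- w + x)" for n x
      using prob_weights_translate[OF P(1) w] Wadd by auto
    have \<Phi>_tr: "\<Phi> (\<lambda>v. P n (- w + v)) = \<Phi> (P n)" for n
      unfolding \<Phi>_def tr(2)
      by (rule integral_left_translate[where f = "\<lambda>x. (left_avg (P n) f x)\<^sup>2"])
         (intro continuous_intros continuous_on_left_avg f)
    have "(\<lambda>n. left_avg (P n) f (- w + g) - left_avg (P n) f g) \<longlonglongrightarrow> 0"
    proof (rule LIMSEQ_I)
      fix e :: real assume e: "e > 0"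
      then obtain N where N: "\<And>n p q x. \<lbrakk>n \<ge> N; p \<in> prob_weights W; q \<in> prob_weights W;
        \<Phi> p < m + inverse (real (Suc n)); \<Phi> q < m + inverse (real (Suc n))\<rbrakk> \<Longrightarrow>
        \<bar>left_avg p f x - left_avg q f x\<bar> \<le> e / 2" using close[of "e / 2"] by force
      have "norm (left_avg (P n) f (- w + g) - left_avg (P n) f g - 0) < e" if "n \<ge> N" for n
      proof -
        have "\<bar>left_avg (P n) f (- w + g) - left_avg (P n) f g\<bar> \<le> e / 2"
          using N[OF that tr(1) P(1), of n n g] P(2)[of n] \<Phi>_tr[of n] by (simp add: tr(2))
        with e show ?thesis by simp
      qed
      then show "\<exists>no. \<forall>n\<ge>no. norm (left_avg (P n) f (- w + g) - left_avg (P n) f g - 0) < e"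
        by blast
    qed
    moreover have "(\<lambda>n. left_avg (P n) f (- w + g) - left_avg (P n) f g) \<longlonglongrightarrow> u (- w + g) - u g"
      by (intro tendsto_diff lim)
    ultimately show ?thesis using LIMSEQ_unique by fastforce
  qed
  show thesis
    by (rule that[OF cont _ P(1) u]) (use inv Wminus in \<open>metis minus_minus\<close>)
qed

section \<open>Averaging preserves integrals\<close>

lemma integral_left_avg:
  assumes f: "continuous_on UNIV f" and p: "p \<in> prob_weights W"
  shows "(\<integral>x. left_avg p f x \<partial>\<nu>) = (\<integral>x. f x \<partial>\<nu>)"
proof -
  have "integrable \<nu> (\<lambda>x. f (- w + x))" for w
    by (intro integrable_continuous continuous_on_left_translate f)
  then have "(\<integral>x. left_avg p f x \<partial>\<nu>) = (\<Sum>w | p w \<noteq> 0. p w * (\<integral>x. f x \<partial>\<nu>))"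
    unfolding left_avg_def by (subst Bochner_Integration.integral_sum) (auto simp: integral_left_translate[OF f])
  then show ?thesis using prob_weightsD(4)[OF p] by (simp add: sum_distrib_right[symmetric])
qed

lemma integral_uniform_limit:
  fixes k :: "nat \<Rightarrow> 'a \<Rightarrow> real"
  assumes k: "\<And>n. continuous_on UNIV (k n)" and lim: "uniform_limit UNIV k u sequentially"
  shows "(\<lambda>n. \<integral>x. k n x \<partial>\<nu>) \<longlonglongrightarrow> (\<integral>x. u x \<partial>\<nu>)"
proof (rule LIMSEQ_I)
  have u: "continuous_on UNIV u" by (rule uniform_limit_theorem[OF _ lim]) (auto simp: k)
  fix e :: real assume e: "e > 0"
  then obtain N where N: "\<And>n x. n \<ge> N \<Longrightarrow> \<bar>k n x - u x\<bar> < e / 2"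
    using lim[unfolded uniform_limit_sequentially_iff, rule_format, of "e / 2"] by (auto simp: dist_real_def)
  have "norm ((\<integral>x. k n x \<partial>\<nu>) - (\<integral>x. u x \<partial>\<nu>)) < e" if "n \<ge> N" for n
  proof -
    have "norm (\<integral>x. k n x - u x \<partial>\<nu>) \<le> (\<integral>x. norm (k n x - u x) \<partial>\<nu>)" by simp
    also have "\<dots> \<le> (\<integral>x. e / 2 \<partial>\<nu>)"
      by (intro integral_mono integrable_continuous continuous_intros k u)
         (use N[OF that] in \<open>auto intro: less_imp_le\<close>)
    also have "\<dots> < e" using e prob_space by simp
    finally show ?thesis using integrable_continuous[OF k] integrable_continuous[OF u] by simp
  qed
  then show "\<exists>N. \<forall>n\<ge>N. norm ((\<integral>x. k n x \<partial>\<nu>) - (\<integral>x. u x \<partial>\<nu>)) < e" by blast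
qed

text \<open>Left averages over the whole group converge to a constant, which must be the integral;
  right translation commutes with left averaging and fixes the constant.\<close>
lemma integral_right_translate:
  fixes f :: "'a \<Rightarrow> real"
  assumes f: "continuous_on UNIV f"
  shows "(\<integral>x. f (x + g) \<partial>\<nu>) = (\<integral>x. f x \<partial>\<nu>)"
proof -
  obtain u P where u: "\<And>w g. u (w + g) = u g" "\<And>n. P n \<in> prob_weights UNIV"
    "uniform_limit UNIV (\<lambda>n. left_avg (P n) f) u sequentially"
    using left_invariant_mean[OF f, of UNIV] by (metis UNIV_I)
  have const: "u x = u 0" for x using u(1)[of x 0] by simp
  have fg: "continuous_on UNIV (\<lambda>x. f (x + g))"
    by (rule continuous_on_right_translate[OF f])
  have "uniform_limit UNIV (\<lambda>n. left_avg (P n) (\<lambda>x. f (x + g))) u sequentially"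
    unfolding uniform_limit_sequentially_iff
  proof (intro allI impI)
    fix e :: real assume "e > 0"
    then obtain N where "\<And>n x. n \<ge> N \<Longrightarrow> dist (left_avg (P n) f x) (u x) < e"
      using u(3) unfolding uniform_limit_sequentially_iff by blast
    moreover have "left_avg (P n) (\<lambda>x. f (x + g)) x = left_avg (P n) f (x + g)" for n x
      by (simp add: left_avg_def add.assoc)
    ultimately show "\<exists>N. \<forall>n\<ge>N. \<forall>x\<in>UNIV. dist (left_avg (P n) (\<lambda>x. f (x + g)) x) (u x) < e"
      using const by metis
  qed
  from integral_uniform_limit[OF continuous_on_left_avg[OF fg] this]
    integral_uniform_limit[OF continuous_on_left_avg[OF f] u(3)]
  show ?thesis
    by (simp add: integral_left_avg[OF f u(2)] integral_left_avg[OF fg u(2)] LIMSEQ_const_iff)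
qed

lemma integral_right_avg:
  assumes f: "continuous_on UNIV f" and p: "p \<in> prob_weights W"
  shows "(\<integral>x. right_avg p f x \<partial>\<nu>) = (\<integral>x. f x \<partial>\<nu>)"
proof -
  have "integrable \<nu> (\<lambda>x. f (x + w))" for w
    by (intro integrable_continuous continuous_on_right_translate f)
  then have "(\<integral>x. right_avg p f x \<partial>\<nu>) = (\<Sum>w | p w \<noteq> 0. p w * (\<integral>x. f x \<partial>\<nu>))"
    unfolding right_avg_def by (subst Bochner_Integration.integral_sum) (auto simp: integral_right_translate[OF f])
  then show ?thesis using prob_weightsD(4)[OF p] by (simp add: sum_distrib_right[symmetric])
qed

section \<open>Feasible functions and their symmetrization\<close>

text \<open>Integrate \<open>h g \<le> h 0\<close> over a probability space. This supplies the lower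
  bound that comparing real infima requires.\<close>

lemma feasible_value_ge_1:
  assumes "h \<in> feasible \<nu> A"
  shows "1 \<le> h 0"
proof -
  have pd: "pos_def_fun (\<lambda>x. complex_of_real (h x))" and c: "continuous_on UNIV (\<lambda>x. complex_of_real (h x))"
    and i: "(\<integral>x. h x \<partial>\<nu>) = 1"
    using assms by (auto simp: feasible_def C_psd_def)
  have "continuous_on UNIV h" using continuous_on_Re[OF c] by simp
  then have "(\<integral>x. h x \<partial>\<nu>) \<le> (\<integral>x. h 0 \<partial>\<nu>)"
    by (intro integral_mono integrable_continuous pos_def_real_le[OF pd]) auto
  then show ?thesis using i prob_space by simp
qed

text \<open>Positive definiteness, the sign condition and the integral hold for every two-sided
  average and pass to the uniform limit; invariance is obtained from the limit.\<close>

lemma feasible_symmetrization: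
  assumes h: "h \<in> feasible \<nu> A"
    and W0: "0 \<in> W" and Wadd: "\<And>x y. x \<in> W \<Longrightarrow> y \<in> W \<Longrightarrow> x + y \<in> W"
    and Wminus: "\<And>x. x \<in> W \<Longrightarrow> - x \<in> W"
    and A: "\<And>w. w \<in> W \<Longrightarrow> (\<lambda>a. w + a) ` A = A \<and> (\<lambda>a. a + w) ` A = A"
  obtains v where "v \<in> feasible \<nu> A" "v 0 \<le> h 0"
    "\<And>g w. w \<in> W \<Longrightarrow> v (w + g) = v g" "\<And>g w. w \<in> W \<Longrightarrow> v (g + w) = v g"
proof -
  have pd: "pos_def_fun (\<lambda>x. complex_of_real (h x))" and c: "continuous_on UNIV (\<lambda>x. complex_of_real (h x))"
    and i: "(\<integral>x. h x \<partial>\<nu>) = 1" and neg: "\<And>g. g \<notin> A \<Longrightarrow> h g \<le> 0"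
    using h by (auto simp: feasible_def C_psd_def)
  have hc: "continuous_on UNIV h" using continuous_on_Re[OF c] by simp
  note even = pos_def_real_even[OF pd]
  obtain u P where u: "continuous_on UNIV u" "\<And>w g. w \<in> W \<Longrightarrow> u (w + g) = u g"
    and P: "\<And>n. P n \<in> prob_weights W"
    and lim_u: "uniform_limit UNIV (\<lambda>n. left_avg (P n) h) u sequentially"
    using left_invariant_mean[OF hc W0 Wadd Wminus] by blast
  define V where "V n = left_avg (P n) (right_avg (P n) h)" for n
  have Vc: "continuous_on UNIV (V n)" for n
    unfolding V_def by (intro continuous_on_left_avg continuous_on_right_avg hc)

  text \<open>Up to small errors, \<open>V n\<close> is the left average of \<open>u \<circ> uminus\<close>, which agrees with the right
    average of \<open>u\<close> for any later weight because left and right averaging commute.\<close>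
  have key: "\<bar>V n x - right_avg (P k) u x\<bar> \<le> 3 * e"
    if a: "\<And>x. \<bar>left_avg (P n) h x - u x\<bar> \<le> e" and b: "\<And>x. \<bar>left_avg (P k) h x - u x\<bar> \<le> e" for n k e x
  proof -
    have R: "\<bar>right_avg (P l) h x - u (- x)\<bar> \<le> e" if "\<And>x. \<bar>left_avg (P l) h x - u x\<bar> \<le> e" for l x
      using that[of "- x"] by (simp add: right_avg_eq_left_avg even)
    have "\<bar>V n x - left_avg (P n) (\<lambda>x. u (- x)) x\<bar> \<le> e"
      unfolding V_def by (rule left_avg_close[OF P]) (rule R[OF a])
    moreover have "\<bar>left_avg (P n) (right_avg (P k) h) x - left_avg (P n) (\<lambda>x. u (- x)) x\<bar> \<le> e"
      by (rule left_avg_close[OF P]) (rule R[OF b])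
    moreover have "\<bar>right_avg (P k) (left_avg (P n) h) x - right_avg (P k) u x\<bar> \<le> e"
      by (rule right_avg_close[OF P]) (rule a)
    ultimately show ?thesis unfolding left_avg_right_avg_commute by linarith
  qed
  \<comment> \<open>The indices \<open>n\<close> and \<open>k\<close> are independent. Comparing
    with the fixed function at \<open>k = N\<close> makes \<open>V\<close> Cauchy, and letting
    \<open>n\<close> tend to infinity keeps the limit within \<open>e\<close> of that
    function.\<close>
  have close: "\<exists>N. \<forall>n\<ge>N. \<forall>k\<ge>N. \<forall>x. \<bar>V n x - right_avg (P k) u x\<bar> \<le> e" if "e > 0" for e
  proof -
    obtain N where "\<And>n x. n \<ge> N \<Longrightarrow> \<bar>left_avg (P n) h x - u x\<bar> < e / 3"
      using lim_u[unfolded uniform_limit_sequentially_iff, rule_format, of "e / 3"] \<open>e > 0\<close>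
      by (auto simp: dist_real_def)
    then show ?thesis using key[of _ "e / 3"] by (intro exI[of _ N]) (simp add: less_imp_le)
  qed
  have "uniformly_Cauchy_on UNIV V"
  proof (rule uniformly_Cauchy_onI)
    fix e :: real assume e: "e > 0"
    then obtain N where N: "\<And>n k x. n \<ge> N \<Longrightarrow> k \<ge> N \<Longrightarrow> \<bar>V n x - right_avg (P k) u x\<bar> \<le> e / 3"
      using close[of "e / 3"] by auto
    have "dist (V k x) (V n x) < e" if "k \<ge> N" "n \<ge> N" for k n x
      using N[OF that(1) order_refl, of x] N[OF that(2) order_refl, of x] e
      unfolding dist_real_def by linarith
    then show "\<exists>M. \<forall>x\<in>UNIV. \<forall>k\<ge>M. \<forall>n\<ge>M. dist (V k x) (V n x) < e" by blast
  qed
  then obtain v where lim_v: "uniform_limit UNIV V v sequentially"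
    using Cauchy_uniformly_convergent uniformly_convergent_on_def by blast
  have vc: "continuous_on UNIV v"
    by (rule uniform_limit_theorem[OF _ lim_v]) (auto simp: Vc)
  have lim: "(\<lambda>n. V n x) \<longlonglongrightarrow> v x" for x
    by (rule tendsto_uniform_limitI[OF lim_v]) simp
  have "(\<lambda>n. complex_of_real (V n x)) \<longlonglongrightarrow> complex_of_real (v x)" for x
    by (intro tendsto_of_real lim)
  then have vpd: "pos_def_fun (\<lambda>x. complex_of_real (v x))"
    by (rule pos_def_fun_limit[rotated])
       (unfold V_def, intro pos_def_two_sided_avg pd prob_weightsD(1)[OF P])
  \<comment> \<open>A bound for \<open>h\<close> on \<open>W + g + W\<close> survives averaging and
    the limit. It is applied with \<open>b = 0\<close> outside \<open>A\<close> and with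
    \<open>b = h 0\<close> at the identity.\<close>
  have V_le: "V n g \<le> b" if "\<And>w w'. w \<in> W \<Longrightarrow> w' \<in> W \<Longrightarrow> h (- w + g + w') \<le> b" for n g b
    unfolding V_def by (intro left_avg_le[OF P] right_avg_le[OF P] that)
  have v_le: "v g \<le> b" if "\<And>w w'. w \<in> W \<Longrightarrow> w' \<in> W \<Longrightarrow> h (- w + g + w') \<le> b" for g b
    by (rule LIMSEQ_le_const2[OF lim]) (use V_le that in blast)
  have v_neg: "v g \<le> 0" if g: "g \<notin> A" for g
  proof (rule v_le, rule neg)
    fix w w' assume w: "w \<in> W" "w' \<in> W"
    show "- w + g + w' \<notin> A"
    proof
      assume "- w + g + w' \<in> A"
      then have "w + (- w + g + w') \<in> A" using A[OF w(1)] by blast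
      then have "w + (- w + g + w') + - w' \<in> A" using A[OF Wminus[OF w(2)]] by blast
      then show False using g by (simp add: add.assoc del: add_uminus_conv_diff)
    qed
  qed
  have "(\<integral>x. V n x \<partial>\<nu>) = 1" for n
    unfolding V_def integral_left_avg[OF continuous_on_right_avg[OF hc] P] integral_right_avg[OF hc P] by (rule i)
  then have v_int: "(\<integral>x. v x \<partial>\<nu>) = 1"
    using integral_uniform_limit[OF Vc lim_v] by (simp add: LIMSEQ_const_iff)
  \<comment> \<open>\<open>right_avg (P N) u\<close> inherits the left invariance of
    \<open>u\<close>. As \<open>v\<close> is within \<open>e\<close> of it, \<open>v (w + g)\<close>
    and \<open>v g\<close> differ by at most \<open>2 * e\<close>, whereas \<open>e\<close> is
    chosen as a third of their distance.\<close>
  have left: "v (w + g) = v g" if w: "w \<in> W" for w g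
  proof (rule ccontr)
    assume ne: "v (w + g) \<noteq> v g"
    define e where "e = \<bar>v (w + g) - v g\<bar> / 3"
    have e: "e > 0" using ne by (simp add: e_def)
    then obtain N where N: "\<And>n k x. n \<ge> N \<Longrightarrow> k \<ge> N \<Longrightarrow> \<bar>V n x - right_avg (P k) u x\<bar> \<le> e"
      using close[of e] by auto
    have "\<bar>v x - right_avg (P N) u x\<bar> \<le> e" for x
      by (rule LIMSEQ_le_const2[where X = "\<lambda>n. \<bar>V n x - right_avg (P N) u x\<bar>"])
         (use N in \<open>auto intro!: tendsto_intros lim\<close>)
    from this[of g] this[of "w + g"]
    have "\<bar>v (w + g) - v g\<bar> \<le> 2 * e"
      using u(2)[OF w] by (simp add: right_avg_def add.assoc)
    then show False using e by (simp add: e_def)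
  qed
  \<comment> \<open>Evenness of \<open>v\<close> turns right translation by \<open>w\<close> into
    left translation by \<open>- w\<close>.\<close>
  have right: "v (g + w) = v g" if w: "w \<in> W" for w g
    using left[OF Wminus[OF w], of "- g"] pos_def_real_even[OF vpd, of "g + w"] pos_def_real_even[OF vpd, of g]
    by (simp add: minus_add)
  have "v \<in> feasible \<nu> A"
    using vpd vc v_neg v_int by (auto simp: feasible_def C_psd_def intro!: continuous_intros)
  moreover have "v 0 \<le> h 0" by (rule v_le) (rule pos_def_real_le[OF pd])
  ultimately show thesis using left right that by blast
qed

end

theorem theoremA1:
  fixes \<nu> :: "'a::{t2_space,group_add} measure" and A W :: "'a set"
  assumes "topological_group TYPE('a)"
    and "compact (UNIV :: 'a set)"
    and "haar_prob \<nu>"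
    and "uminus ` A = A" and "0 \<in> A"
    and "closed W" and "0 \<in> W" and "\<And>x y. x \<in> W \<Longrightarrow> y \<in> W \<Longrightarrow> x + y \<in> W"
    and "\<And>x. x \<in> W \<Longrightarrow> - x \<in> W"
    and "\<And>w. w \<in> W \<Longrightarrow> (\<lambda>a. w + a) ` A = A \<and> (\<lambda>a. a + w) ` A = A"
  shows "B_val \<nu> A = Inf ((\<lambda>h. h 0) `
           {h \<in> feasible \<nu> A. \<forall>g. \<forall>w\<in>W. h (w + g) = h g \<and> h (g + w) = h g})"
proof -
  interpret compact_haar_group \<nu> by (unfold_locales) (fact assms)+
  let ?F = "feasible \<nu> A"
  let ?S = "{h \<in> ?F. \<forall>g. \<forall>w\<in>W. h (w + g) = h g \<and> h (g + w) = h g}"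
  have sym: "\<exists>v\<in>?S. v 0 \<le> h 0" if "h \<in> ?F" for h
    by (rule feasible_symmetrization[OF that assms(7-10)]) auto
  have bdd: "bdd_below ((\<lambda>h. h 0) ` ?F)"
    using feasible_value_ge_1 by (intro bdd_belowI[of _ 1]) auto
  show ?thesis
  proof (cases "?F = {}")
    \<comment> \<open>Both sides are then \<open>Inf\<close> of the empty set, so they agree
      whatever that value is.\<close>
    case True
    then show ?thesis by (simp add: B_val_def)
  next
    case False
    then have "?S \<noteq> {}" using sym by blast
    show ?thesis
      unfolding B_val_def
    proof (rule antisym)
      show "Inf ((\<lambda>h. h 0) ` ?F) \<le> Inf ((\<lambda>h. h 0) ` ?S)"
        by (rule cInf_superset_mono) (use \<open>?S \<noteq> {}\<close> bdd in auto)
      have "bdd_below ((\<lambda>h. h 0) ` ?S)" by (rule bdd_below_mono[OF bdd]) auto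
      then show "Inf ((\<lambda>h. h 0) ` ?S) \<le> Inf ((\<lambda>h. h 0) ` ?F)"
        using False sym by (intro cInf_mono) auto
    qed
  qed
qed

end
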